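(* If the black-box Match-Alg is set to be the greedy matching algorithm, then Algorithm 1 computes a $\frac{1}{5}$-approximation to the optimal solution of the BR-MWM problem in $O(m \log^2m + n \log m)$-time.
   Context: Uncertain weighted graph: $n$ nodes, edge set $E$ with $|E|=m$; the reward $w(e)$ of each edge $e$ is drawn independently from a distribution $f_e$ with finite mean $r_e$ (expected reward) and standard deviation $\sigma_e$. For a matching $M$, $R(M)=\sum_{e\in M} r_e$ and $risk(M)=\sum_{e\in M}\sigma_e$. The BR-MWM (Bounded Risk Maximum Weighted Matching) problem: given a budget $B$, maximize $R(M)$ over all matchings $M$ with $risk(M)\le B$. The greedy matching algorithm sorts edges by decreasing weight and adds each to the matching if it is disjoint from those already chosen; it is a $\frac{1}{2}$-approximation to maximum weight matching and runs in $O(m\log m+n)$ time. Algorithm 1 (takes a black-box algorithm Match-Alg that, given a weighted graph, returns a matching): remove all edges with $r_e\le 0$ or $\sigma_e>B$; sort the remaining ones as $e_1,\dots,e_m$ so that $\alpha_{e_1}\ge\dots\ge\alpha_{e_m}$ where $\alpha_e=r_e/\sigma_e$; let $H^{(i)}$ contain $e_1,\dots,e_i$ with weights $r_e$, and let $M^{(i)}$ be the output of Match-Alg on $H^{(i)}$. If $risk(M^{(m)})\le B$, output $M^{(m)}$. Otherwise binary search (using $O(\log m)$ calls to Match-Alg) for an index $\ell^*$ with $risk(M^{(\ell^* )})\le B< risk(M^{(\ell^*+1)})$, and output whichever of $M^{(\ell^* )}$ and $\{e_{\ell^*+1}\}$ has greater expected reward. *)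

theory Defs
  imports "HOL-Probability.Probability" "HOL-Library.Monad_Syntax"
begin

section \<open>Uncertain weighted graphs\<close>

text \<open>
  The nodes are \<open>0, \<dots>, n - 1\<close>; an undirected edge is stored as the pair of its end points,
  the smaller one first. The edge set is given as a list without repetitions, in arbitrary order,
  since this is what the algorithms receive.
\<close>

type_synonym edge = "nat \<times> nat"

record ugraph =
  num_nodes :: nat
  edge_list :: "edge list"
  law :: "edge \<Rightarrow> real measure"

definition num_edges :: "ugraph \<Rightarrow> nat" where
  "num_edges G = card (set (edge_list G))"

definition uncertain_graph :: "ugraph \<Rightarrow> bool" where
  "uncertain_graph G \<longleftrightarrow>
     distinct (edge_list G) \<and>
     (\<forall>(u, v) \<in> set (edge_list G). u < v \<and> v < num_nodes G) \<and>
     (\<forall>e \<in> set (edge_list G). real_distribution (law G e) \<and>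
        integrable (law G e) (\<lambda>x. x) \<and> integrable (law G e) (\<lambda>x. x\<^sup>2))"

text \<open>
  The joint law of independent rewards \<open>w(e)\<close> with distributions \<open>law G e\<close>;
  \<open>w(e)\<close> is the coordinate function \<open>\<lambda>w. w e\<close>.
\<close>

definition reward_space :: "ugraph \<Rightarrow> (edge \<Rightarrow> real) measure" where
  "reward_space G = PiM (set (edge_list G)) (law G)"

definition exp_reward :: "ugraph \<Rightarrow> edge \<Rightarrow> real" where
  "exp_reward G e = prob_space.expectation (reward_space G) (\<lambda>w. w e)"

definition std_dev :: "ugraph \<Rightarrow> edge \<Rightarrow> real" where
  "std_dev G e = sqrt (prob_space.variance (reward_space G) (\<lambda>w. w e))"

lemma distr_reward:
  assumes "uncertain_graph G" and "e \<in> set (edge_list G)"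
  shows "distr (reward_space G) (law G e) (\<lambda>w. w e) = law G e"
  unfolding reward_space_def
  by (rule distr_PiM_component)
     (use assms in \<open>auto simp: uncertain_graph_def real_distribution_def\<close>)

lemma integral_reward:
  fixes g :: "real \<Rightarrow> real"
  assumes "uncertain_graph G" and "e \<in> set (edge_list G)" and "g \<in> borel_measurable borel"
  shows "(\<integral>w. g (w e) \<partial>reward_space G) = (\<integral>x. g x \<partial>law G e)"
proof -
  interpret real_distribution "law G e"
    using assms by (auto simp: uncertain_graph_def)
  have "(\<integral>x. g x \<partial>distr (reward_space G) (law G e) (\<lambda>w. w e)) = (\<integral>w. g (w e) \<partial>reward_space G)"
    using assms(2,3) by (intro integral_distr) (auto simp: reward_space_def)
  then show ?thesis
    using distr_reward[OF assms(1,2)] by simp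
qed

lemma exp_reward_eq:
  "uncertain_graph G \<Longrightarrow> e \<in> set (edge_list G) \<Longrightarrow> exp_reward G e = (\<integral>x. x \<partial>law G e)"
  unfolding exp_reward_def using integral_reward[of G e "\<lambda>x. x"] by simp

lemma std_dev_eq:
  assumes "uncertain_graph G" and "e \<in> set (edge_list G)"
  shows "std_dev G e = sqrt (\<integral>x. (x - exp_reward G e)\<^sup>2 \<partial>law G e)"
  unfolding std_dev_def exp_reward_def[symmetric]
  using integral_reward[of G e "\<lambda>x. (x - exp_reward G e)\<^sup>2"] assms by simp

section \<open>Bounded risk maximum weight matching\<close>

definition is_matching :: "edge set \<Rightarrow> edge set \<Rightarrow> bool" where
  "is_matching E M \<longleftrightarrow> M \<subseteq> E \<and>
     (\<forall>(u, v) \<in> M. \<forall>(u', v') \<in> M. (u, v) \<noteq> (u', v') \<longrightarrow> {u, v} \<inter> {u', v'} = {})"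

definition reward :: "ugraph \<Rightarrow> edge set \<Rightarrow> real" where
  "reward G M = (\<Sum>e\<in>M. exp_reward G e)"

definition risk :: "ugraph \<Rightarrow> edge set \<Rightarrow> real" where
  "risk G M = (\<Sum>e\<in>M. std_dev G e)"

definition br_feasible :: "ugraph \<Rightarrow> real \<Rightarrow> edge set set" where
  "br_feasible G B = {M. is_matching (set (edge_list G)) M \<and> risk G M \<le> B}"

definition br_opt :: "ugraph \<Rightarrow> real \<Rightarrow> real" where
  "br_opt G B = Max (reward G ` br_feasible G B)"

definition br_approximation :: "real \<Rightarrow> ugraph \<Rightarrow> real \<Rightarrow> edge set \<Rightarrow> bool" where
  "br_approximation c G B M \<longleftrightarrow> M \<in> br_feasible G B \<and> reward G M \<ge> c * br_opt G B"

section \<open>Programs with running time\<close>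

text \<open>
  A timed computation carries its result and its number of steps. Every (recursive) call of a
  program below is charged one step by \<open>tick\<close>. Such a call performs, besides the further calls
  that it makes, only a bounded number of elementary operations: arithmetic and comparisons on
  (extended) real numbers and indices, access to the two numbers stored with an edge, and
  list constructors. Lists have to be traversed; only arrays have constant-time access.
\<close>

datatype 'a tm = TM (val: 'a) (time: nat)

definition return_tm :: "'a \<Rightarrow> 'a tm" where
  "return_tm x = TM x 0"

definition bind_tm :: "'a tm \<Rightarrow> ('a \<Rightarrow> 'b tm) \<Rightarrow> 'b tm" where
  "bind_tm m f = TM (val (f (val m))) (time m + time (f (val m)))"

definition tick :: "'a tm \<Rightarrow> 'a tm" where
  "tick m = TM (val m) (time m + 1)"

adhoc_overloading Monad_Syntax.bind \<rightleftharpoons> bind_tm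

lemma bind_tm_cong [fundef_cong]:
  "m = m' \<Longrightarrow> (\<And>x. x = val m' \<Longrightarrow> f x = f' x) \<Longrightarrow> bind_tm m f = bind_tm m' f'"
  by (simp add: bind_tm_def)

lemma val_simps [simp]:
  "val (return_tm x) = x"
  "val (bind_tm m f) = val (f (val m))"
  "val (tick m) = val m"
  by (simp_all add: return_tm_def bind_tm_def tick_def)

lemma time_simps [simp]:
  "time (return_tm x) = 0"
  "time (bind_tm m f) = time m + time (f (val m))"
  "time (tick m) = time m + 1"
  by (simp_all add: return_tm_def bind_tm_def tick_def)

text \<open>Arrays, represented by the list of their entries.\<close>

type_synonym 'a array = "'a list"

definition array_new :: "nat \<Rightarrow> 'a \<Rightarrow> 'a array tm" where
  "array_new n x = TM (replicate n x) (n + 1)"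

definition array_get :: "'a array \<Rightarrow> nat \<Rightarrow> 'a tm" where
  "array_get a i = TM (a ! i) 1"

definition array_set :: "'a array \<Rightarrow> nat \<Rightarrow> 'a \<Rightarrow> 'a array tm" where
  "array_set a i x = TM (a[i := x]) 1"

fun length_tm :: "'a list \<Rightarrow> nat tm" where
  "length_tm [] = tick (return_tm 0)"
| "length_tm (x # xs) = tick (do { n \<leftarrow> length_tm xs; return_tm (n + 1) })"

fun take_tm :: "nat \<Rightarrow> 'a list \<Rightarrow> 'a list tm" where
  "take_tm n [] = tick (return_tm [])"
| "take_tm n (x # xs) = tick
     (if n = 0 then return_tm [] else do { ys \<leftarrow> take_tm (n - 1) xs; return_tm (x # ys) })"

fun drop_tm :: "nat \<Rightarrow> 'a list \<Rightarrow> 'a list tm" where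
  "drop_tm n [] = tick (return_tm [])"
| "drop_tm n (x # xs) = tick (if n = 0 then return_tm (x # xs) else drop_tm (n - 1) xs)"

fun nth_tm :: "'a list \<Rightarrow> nat \<Rightarrow> 'a tm" where
  "nth_tm [] i = tick (return_tm ([] ! i))"
| "nth_tm (x # xs) i = tick (if i = 0 then return_tm x else nth_tm xs (i - 1))"

fun filter_tm :: "('a \<Rightarrow> bool) \<Rightarrow> 'a list \<Rightarrow> 'a list tm" where
  "filter_tm P [] = tick (return_tm [])"
| "filter_tm P (x # xs) = tick
     (do { ys \<leftarrow> filter_tm P xs; return_tm (if P x then x # ys else ys) })"

fun sum_tm :: "('a \<Rightarrow> real) \<Rightarrow> 'a list \<Rightarrow> real tm" where
  "sum_tm f [] = tick (return_tm 0)"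
| "sum_tm f (x # xs) = tick (do { s \<leftarrow> sum_tm f xs; return_tm (f x + s) })"

lemma val_length_tm [simp]: "val (length_tm xs) = length xs"
  by (induction xs) auto

lemma val_take_tm [simp]: "val (take_tm n xs) = take n xs"
  by (induction n xs rule: take_tm.induct) (auto simp: take_Cons')

lemma val_drop_tm [simp]: "val (drop_tm n xs) = drop n xs"
  by (induction n xs rule: drop_tm.induct) (auto simp: drop_Cons')

lemma val_nth_tm [simp]: "val (nth_tm xs i) = xs ! i"
  by (induction xs i rule: nth_tm.induct) (auto simp: nth_Cons')

lemma val_filter_tm [simp]: "val (filter_tm P xs) = filter P xs"
  by (induction xs) auto

lemma val_sum_tm [simp]: "val (sum_tm f xs) = (\<Sum>x\<leftarrow>xs. f x)"
  by (induction xs) auto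

text \<open>Merge sort by decreasing key.\<close>

fun merge_tm :: "('a \<Rightarrow> 'k::linorder) \<Rightarrow> 'a list \<Rightarrow> 'a list \<Rightarrow> 'a list tm" where
  "merge_tm key [] ys = tick (return_tm ys)"
| "merge_tm key (x # xs) [] = tick (return_tm (x # xs))"
| "merge_tm key (x # xs) (y # ys) = tick
     (if key x \<ge> key y
      then do { zs \<leftarrow> merge_tm key xs (y # ys); return_tm (x # zs) }
      else do { zs \<leftarrow> merge_tm key (x # xs) ys; return_tm (y # zs) })"

function msort_tm :: "('a \<Rightarrow> 'k::linorder) \<Rightarrow> 'a list \<Rightarrow> 'a list tm" where
  "msort_tm key xs = tick (do {
     n \<leftarrow> length_tm xs;
     if n \<le> 1 then return_tm xs
     else do {
       ys \<leftarrow> take_tm (n div 2) xs;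
       zs \<leftarrow> drop_tm (n div 2) xs;
       ys' \<leftarrow> msort_tm key ys;
       zs' \<leftarrow> msort_tm key zs;
       merge_tm key ys' zs'
     }
   })"
  by pat_completeness auto
termination
  by (relation "Wellfounded.measure (\<lambda>(key, xs). length xs)") auto

declare msort_tm.simps [simp del]

section \<open>Greedy matching\<close>

text \<open>A matching algorithm receives the number of nodes, the edges and the edge weights.\<close>

type_synonym match_alg = "nat \<Rightarrow> edge list \<Rightarrow> (edge \<Rightarrow> real) \<Rightarrow> edge list tm"

text \<open>The array \<open>used\<close> marks the nodes covered by the edges chosen so far.\<close>

fun greedy_scan :: "edge list \<Rightarrow> bool array \<Rightarrow> edge list tm" where
  "greedy_scan [] used = tick (return_tm [])"
| "greedy_scan ((u, v) # es) used = tick (do {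
     a \<leftarrow> array_get used u;
     b \<leftarrow> array_get used v;
     if a \<or> b then greedy_scan es used
     else do {
       used' \<leftarrow> array_set used u True;
       used'' \<leftarrow> array_set used' v True;
       M \<leftarrow> greedy_scan es used'';
       return_tm ((u, v) # M)
     }
   })"

definition greedy_matching :: match_alg where
  "greedy_matching n es wt = tick (do {
     es' \<leftarrow> msort_tm wt es;
     used \<leftarrow> array_new n False;
     greedy_scan es' used
   })"

section \<open>The bounded risk matching algorithm\<close>

text \<open>\<open>M\<^sup>(\<^sup>i\<^sup>)\<close>, the matching computed on the first \<open>i\<close> edges of \<open>es\<close>.\<close>

definition prefix_matching ::
  "match_alg \<Rightarrow> nat \<Rightarrow> edge list \<Rightarrow> (edge \<Rightarrow> real) \<Rightarrow> nat \<Rightarrow> edge list tm" where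
  "prefix_matching match n es r i = tick (do { H \<leftarrow> take_tm i es; match n H r })"

text \<open>Invariant: the risk of \<open>M\<^sup>(\<^sup>l\<^sup>o\<^sup>)\<close> is at most \<open>B\<close>, that of \<open>M\<^sup>(\<^sup>h\<^sup>i\<^sup>)\<close> exceeds \<open>B\<close>.\<close>

function binary_search ::
  "match_alg \<Rightarrow> nat \<Rightarrow> edge list \<Rightarrow> (edge \<Rightarrow> real) \<Rightarrow> (edge \<Rightarrow> real) \<Rightarrow> real \<Rightarrow>
     nat \<Rightarrow> nat \<Rightarrow> nat tm" where
  "binary_search match n es r \<sigma> B lo hi = tick
     (if hi \<le> lo + 1 then return_tm lo
      else do {
        let mid = (lo + hi) div 2;
        M \<leftarrow> prefix_matching match n es r mid;
        s \<leftarrow> sum_tm \<sigma> M;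
        if s \<le> B then binary_search match n es r \<sigma> B mid hi
        else binary_search match n es r \<sigma> B lo mid
      })"
  by pat_completeness auto
termination
  by (relation "Wellfounded.measure (\<lambda>(match, n, es, r, \<sigma>, B, lo, hi). hi - lo)") auto

declare binary_search.simps [simp del]

text \<open>
  Sorting uses extended reals, so that an edge with \<open>r > 0\<close> and \<open>\<sigma> = 0\<close> has ratio \<open>\<infinity>\<close>.
  List positions start at \<open>0\<close>, so the edge following the first \<open>l\<close> ones is at position \<open>l\<close>.
\<close>

definition br_matching ::
  "match_alg \<Rightarrow> nat \<Rightarrow> edge list \<Rightarrow> (edge \<Rightarrow> real) \<Rightarrow> (edge \<Rightarrow> real) \<Rightarrow> real \<Rightarrow> edge list tm" where
  "br_matching match n E r \<sigma> B = tick (do {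
     E' \<leftarrow> filter_tm (\<lambda>e. \<not> (r e \<le> 0 \<or> \<sigma> e > B)) E;
     es \<leftarrow> msort_tm (\<lambda>e. ereal (r e) / ereal (\<sigma> e)) E';
     m \<leftarrow> length_tm es;
     M \<leftarrow> prefix_matching match n es r m;
     s \<leftarrow> sum_tm \<sigma> M;
     if s \<le> B then return_tm M
     else do {
       l \<leftarrow> binary_search match n es r \<sigma> B 0 m;
       M' \<leftarrow> prefix_matching match n es r l;
       e \<leftarrow> nth_tm es l;
       R \<leftarrow> sum_tm r M';
       return_tm (if R \<ge> r e then M' else [e])
     }
   })"

definition br_greedy :: "ugraph \<Rightarrow> real \<Rightarrow> edge list tm" where
  "br_greedy G B =
     br_matching greedy_matching (num_nodes G) (edge_list G) (exp_reward G) (std_dev G) B"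

end

theory Submission
  imports Defs
begin

text \<open>
  Let \<open>\<ell>\<close> be the index found by the binary search and split an optimal matching \<open>O\<close> into its
  part \<open>O\<^sub>1\<close> among the first \<open>\<ell>\<close> edges and the rest \<open>O\<^sub>2\<close>. Greedy is a \<open>1/2\<close>-approximation, so
  \<open>R(O\<^sub>1) \<le> 2 R(M\<^sup>(\<^sup>\<ell>\<^sup>))\<close>. With \<open>\<alpha>\<close> the ratio of the edge \<open>e\<close> at position \<open>\<ell> + 1\<close>, edges of
  \<open>O\<^sub>2\<close> have ratio at most \<open>\<alpha>\<close> and the edges of \<open>M\<^sup>(\<^sup>\<ell>\<^sup>+\<^sup>1\<^sup>)\<close> at least \<open>\<alpha>\<close>, whence
  \<open>R(O\<^sub>2) \<le> \<alpha> B \<le> \<alpha> risk(M\<^sup>(\<^sup>\<ell>\<^sup>+\<^sup>1\<^sup>)) \<le> R(M\<^sup>(\<^sup>\<ell>\<^sup>+\<^sup>1\<^sup>))\<close>. Dropping \<open>e\<close> from \<open>M\<^sup>(\<^sup>\<ell>\<^sup>+\<^sup>1\<^sup>)\<close> gives a matching of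
  the first \<open>\<ell>\<close> edges, so \<open>R(M\<^sup>(\<^sup>\<ell>\<^sup>+\<^sup>1\<^sup>)) \<le> 2 R(M\<^sup>(\<^sup>\<ell>\<^sup>)) + r\<^sub>e\<close>. In total
  \<open>R(O) \<le> 4 R(M\<^sup>(\<^sup>\<ell>\<^sup>)) + r\<^sub>e\<close>, at most five times the reward of the output.
\<close>

section \<open>Merge sort\<close>

lemma mset_merge_tm [simp]: "mset (val (merge_tm key xs ys)) = mset xs + mset ys"
  by (induction key xs ys rule: merge_tm.induct) auto

lemma set_merge_tm [simp]: "set (val (merge_tm key xs ys)) = set xs \<union> set ys"
  by (metis mset_merge_tm set_mset_mset set_mset_union)

lemma sorted_merge_tm:
  "sorted_wrt (\<lambda>x y. key x \<ge> key y) xs \<Longrightarrow> sorted_wrt (\<lambda>x y. key x \<ge> key y) ys \<Longrightarrow>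
   sorted_wrt (\<lambda>x y. key x \<ge> key y) (val (merge_tm key xs ys))"
  by (induction key xs ys rule: merge_tm.induct) (auto intro: order_trans)

lemma mset_msort_tm [simp]: "mset (val (msort_tm key xs)) = mset xs"
proof (induction key xs rule: msort_tm.induct)
  case (1 key xs)
  show ?case
  proof (cases "length xs \<le> 1")
    case True
    then show ?thesis by (subst msort_tm.simps) simp
  next
    case False
    have "mset (take (length xs div 2) xs) + mset (drop (length xs div 2) xs) = mset xs"
      by (metis append_take_drop_id mset_append)
    with False 1 show ?thesis by (subst msort_tm.simps) simp
  qed
qed

lemma set_msort_tm [simp]: "set (val (msort_tm key xs)) = set xs"
  by (metis mset_msort_tm set_mset_mset)

lemma length_msort_tm [simp]: "length (val (msort_tm key xs)) = length xs"
  by (metis mset_msort_tm size_mset)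

lemma distinct_msort_tm [simp]: "distinct (val (msort_tm key xs)) = distinct xs"
  by (metis mset_msort_tm mset_eq_imp_distinct_iff)

lemma sorted_msort_tm: "sorted_wrt (\<lambda>x y. key x \<ge> key y) (val (msort_tm key xs))"
proof (induction key xs rule: msort_tm.induct)
  case (1 key xs)
  show ?case
  proof (cases "length xs \<le> 1")
    case True
    then have "xs = [] \<or> (\<exists>x. xs = [x])" by (cases xs) auto
    then show ?thesis by (subst msort_tm.simps) auto
  next
    case False
    with 1 show ?thesis by (subst msort_tm.simps) (simp add: sorted_merge_tm)
  qed
qed

lemma time_length_tm [simp]: "time (length_tm xs) = length xs + 1"
  by (induction xs) auto

lemma time_take_tm: "time (take_tm n xs) \<le> n + 1"
  by (induction n xs rule: take_tm.induct) auto

lemma time_take_tm_length: "time (take_tm n xs) \<le> length xs + 1"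
  by (induction n xs rule: take_tm.induct) auto

lemma time_drop_tm: "time (drop_tm n xs) \<le> n + 1"
  by (induction n xs rule: drop_tm.induct) auto

lemma time_nth_tm: "time (nth_tm xs i) \<le> length xs + 1"
  by (induction xs i rule: nth_tm.induct) auto

lemma time_filter_tm [simp]: "time (filter_tm P xs) = length xs + 1"
  by (induction xs) auto

lemma time_sum_tm [simp]: "time (sum_tm f xs) = length xs + 1"
  by (induction xs) auto

lemma time_merge_tm: "time (merge_tm key xs ys) \<le> length xs + length ys + 1"
  by (induction key xs ys rule: merge_tm.induct) auto

lemma time_msort_tm: "length xs \<le> 2 ^ k \<Longrightarrow> time (msort_tm key xs) \<le> 7 * length xs * (k + 1) + 3"
proof (induction k arbitrary: xs)
  case 0
  then show ?case by (subst msort_tm.simps) simp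
next
  case (Suc k)
  show ?case
  proof (cases "length xs \<le> 1")
    case True
    then show ?thesis by (subst msort_tm.simps) simp
  next
    case False
    define h where "h = length xs div 2"
    let ?ys = "take h xs" and ?zs = "drop h xs"
    have h: "h \<le> length xs" "2 * h \<le> length xs" by (auto simp: h_def)
    have ys: "time (msort_tm key ?ys) \<le> 7 * h * (k + 1) + 3"
      using Suc.IH[of ?ys] Suc.prems h by simp
    have "length xs - h \<le> 2 ^ k"
      using Suc.prems unfolding h_def by simp
    then have zs: "time (msort_tm key ?zs) \<le> 7 * (length xs - h) * (k + 1) + 3"
      using Suc.IH[of ?zs] by simp
    have *: "7 * h * (k + 1) + 7 * (length xs - h) * (k + 1) = 7 * length xs * (k + 1)"
      using h by (metis add_mult_distrib add_mult_distrib2 le_add_diff_inverse)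
    have "time (msort_tm key xs) = length xs + 2 + time (take_tm h xs) + time (drop_tm h xs)
        + time (msort_tm key ?ys) + time (msort_tm key ?zs)
        + time (merge_tm key (val (msort_tm key ?ys)) (val (msort_tm key ?zs)))"
      using False by (subst msort_tm.simps) (simp add: h_def)
    moreover have "time (merge_tm key (val (msort_tm key ?ys)) (val (msort_tm key ?zs)))
        \<le> length xs + 1"
      using time_merge_tm[of key "val (msort_tm key ?ys)" "val (msort_tm key ?zs)"] h by simp
    ultimately have "time (msort_tm key xs) \<le> 3 * length xs + 11 + 7 * length xs * (k + 1)"
      using time_take_tm[of h xs] time_drop_tm[of h xs] ys zs * h by linarith
    also have "\<dots> \<le> 7 * length xs * (Suc k + 1) + 3"
      using False by (simp add: algebra_simps)
    finally show ?thesis .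
  qed
qed

section \<open>Greedy matching\<close>

lemma is_matchingI:
  assumes "M \<subseteq> E"
    and "\<And>e e'. e \<in> M \<Longrightarrow> e' \<in> M \<Longrightarrow> e \<noteq> e' \<Longrightarrow> {fst e, snd e} \<inter> {fst e', snd e'} = {}"
  shows "is_matching E M"
  using assms unfolding is_matching_def by fastforce

lemma is_matchingD:
  assumes "is_matching E M" "e \<in> M" "e' \<in> M" "e \<noteq> e'"
  shows "{fst e, snd e} \<inter> {fst e', snd e'} = {}"
  using assms unfolding is_matching_def case_prod_beta prod.collapse by metis

lemma is_matching_subset_edges: "is_matching E M \<Longrightarrow> M \<subseteq> E"
  by (simp add: is_matching_def)

lemma is_matching_mono: "is_matching E M \<Longrightarrow> M' \<subseteq> M \<Longrightarrow> M' \<subseteq> E' \<Longrightarrow> is_matching E' M'"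
  by (metis is_matchingD is_matchingI subsetD)

lemma set_greedy_scan: "set (val (greedy_scan es used)) \<subseteq> set es"
proof (induction es arbitrary: used)
  case (Cons e es)
  then show ?case by (cases e) (auto simp: subset_iff)
qed simp

lemma distinct_greedy_scan: "distinct es \<Longrightarrow> distinct (val (greedy_scan es used))"
proof (induction es arbitrary: used)
  case (Cons e es)
  then show ?case using set_greedy_scan by (cases e) (auto simp: subset_iff)
qed simp

lemma length_greedy_scan: "length (val (greedy_scan es used)) \<le> length es"
proof (induction es arbitrary: used)
  case (Cons e es)
  then show ?case by (cases e) (auto simp: le_SucI)
qed simp

lemma time_greedy_scan: "time (greedy_scan es used) \<le> 5 * length es + 1"
proof (induction es arbitrary: used)
  case (Cons e es)
  then show ?case
    by (cases e) (auto simp: array_get_def array_set_def intro: order_trans[OF Cons.IH])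
qed simp

lemma greedy_scan_matching:
  assumes "\<forall>e\<in>set es. fst e < length used \<and> snd e < length used"
  shows "is_matching (set es) (set (val (greedy_scan es used))) \<and>
    (\<forall>e\<in>set (val (greedy_scan es used)). \<not> used ! fst e \<and> \<not> used ! snd e)"
  using assms
proof (induction es used rule: greedy_scan.induct)
  case (1 used)
  then show ?case by (simp add: is_matching_def)
next
  case (2 u v es used)
  show ?case
  proof (cases "used ! u \<or> used ! v")
    case True
    then have eq: "val (greedy_scan ((u, v) # es) used) = val (greedy_scan es used)"
      by (simp add: array_get_def)
    have "is_matching (set es) (set (val (greedy_scan es used))) \<and>
        (\<forall>e\<in>set (val (greedy_scan es used)). \<not> used ! fst e \<and> \<not> used ! snd e)"
      using "2.IH"(1)[OF refl refl] True "2.prems" by (auto simp: array_get_def)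
    then show ?thesis
      unfolding eq by (auto simp: is_matching_def)
  next
    case False
    define used' where "used' = used[u := True, v := True]"
    define M where "M = val (greedy_scan es used')"
    have eq: "val (greedy_scan ((u, v) # es) used) = (u, v) # M"
      using False by (simp add: array_get_def array_set_def M_def used'_def)
    have uv: "u < length used" "v < length used" using "2.prems" by auto
    have IH: "is_matching (set es) (set M)"
        "\<And>e. e \<in> set M \<Longrightarrow> \<not> used' ! fst e \<and> \<not> used' ! snd e"
      using "2.IH"(2)[OF refl refl _ refl refl] False "2.prems"
      by (auto simp: array_get_def array_set_def M_def used'_def)
    have nth: "used' ! x \<longleftrightarrow> used ! x \<or> x = u \<or> x = v" for x
      using uv by (auto simp: used'_def nth_list_update)
    have free: "\<not> used ! fst e \<and> \<not> used ! snd e \<and> {u, v} \<inter> {fst e, snd e} = {}" if "e \<in> set M" for e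
      using IH(2)[OF that] unfolding nth by auto
    have "is_matching (set ((u, v) # es)) (set ((u, v) # M))"
    proof (rule is_matchingI)
      show "set ((u, v) # M) \<subseteq> set ((u, v) # es)"
        using is_matching_subset_edges[OF IH(1)] by auto
    next
      fix e e' assume "e \<in> set ((u, v) # M)" "e' \<in> set ((u, v) # M)" "e \<noteq> e'"
      then show "{fst e, snd e} \<inter> {fst e', snd e'} = {}"
        using free[of e] free[of e'] is_matchingD[OF IH(1), of e e'] by auto
    qed
    then show ?thesis
      unfolding eq using free False by auto
  qed
qed

text \<open>Choosing \<open>(u, v)\<close> blocks at most one matching edge at \<open>u\<close> and one at \<open>v\<close>, neither heavier.\<close>

lemma sum_matching_meeting_edge:
  fixes w :: "edge \<Rightarrow> real"
  assumes "is_matching E N" "finite N" "c \<ge> 0" "\<And>e. e \<in> N \<Longrightarrow> w e \<le> c"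
  shows "(\<Sum>e | e \<in> N \<and> {fst e, snd e} \<inter> {u, v} \<noteq> {}. w e) \<le> 2 * c"
proof -
  have one: "(\<Sum>e | e \<in> N \<and> x \<in> {fst e, snd e}. c) \<le> c" for x
  proof (cases "{e. e \<in> N \<and> x \<in> {fst e, snd e}} = {}")
    case False
    then obtain e where "e \<in> N" "x \<in> {fst e, snd e}" by blast
    then have "{e. e \<in> N \<and> x \<in> {fst e, snd e}} = {e}"
      using is_matchingD[OF assms(1)] by blast
    then show ?thesis by simp
  qed (use assms(3) in \<open>simp only: sum.empty\<close>)
  let ?A = "\<lambda>x. {e. e \<in> N \<and> x \<in> {fst e, snd e}}"
  have "(\<Sum>e | e \<in> N \<and> {fst e, snd e} \<inter> {u, v} \<noteq> {}. w e)
      \<le> (\<Sum>e | e \<in> N \<and> {fst e, snd e} \<inter> {u, v} \<noteq> {}. c)"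
    using assms(4) by (intro sum_mono) auto
  also have "\<dots> = (\<Sum>e\<in>?A u \<union> ?A v. c)"
    by (rule sum.cong) auto
  also have "(\<Sum>e\<in>?A u \<union> ?A v. c) \<le> (\<Sum>e\<in>?A u. c) + (\<Sum>e\<in>?A v. c)"
    using assms(2,3) by (subst sum_Un) (auto intro!: sum_nonneg simp: field_simps)
  also have "\<dots> \<le> 2 * c"
    using one[of u] one[of v] by linarith
  finally show ?thesis .
qed

lemma greedy_scan_half:
  fixes w :: "edge \<Rightarrow> real"
  assumes "\<forall>e\<in>set es. fst e < length used \<and> snd e < length used"
    and "sorted_wrt (\<lambda>x y. w x \<ge> w y) es" and "\<forall>e\<in>set es. w e \<ge> 0"
    and "is_matching (set es) N" and "\<forall>e\<in>N. \<not> used ! fst e \<and> \<not> used ! snd e"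
  shows "(\<Sum>e\<in>N. w e) \<le> 2 * (\<Sum>e\<leftarrow>val (greedy_scan es used). w e)"
  using assms
proof (induction es used arbitrary: N rule: greedy_scan.induct)
  case (1 used)
  then show ?case by (simp add: is_matching_def)
next
  case (2 u v es used)
  note N = \<open>is_matching (set ((u, v) # es)) N\<close>
  show ?case
  proof (cases "used ! u \<or> used ! v")
    case True
    have "(u, v) \<notin> N" using "2.prems"(5) True by auto
    then have "is_matching (set es) N"
      using is_matching_subset_edges[OF N] by (intro is_matching_mono[OF N]) auto
    then show ?thesis
      using "2.IH"(1)[OF refl refl] True "2.prems" by (simp add: array_get_def)
  next
    case False
    define used' where "used' = used[u := True, v := True]"
    define M where "M = val (greedy_scan es used')"
    have eq: "val (greedy_scan ((u, v) # es) used) = (u, v) # M"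
      using False by (simp add: array_get_def array_set_def M_def used'_def)
    have uv: "u < length used" "v < length used" using "2.prems" by auto
    have nth: "used' ! x \<longleftrightarrow> used ! x \<or> x = u \<or> x = v" for x
      using uv by (auto simp: used'_def nth_list_update)
    define N1 where "N1 = {e. e \<in> N \<and> {fst e, snd e} \<inter> {u, v} \<noteq> {}}"
    have fin: "finite N"
      using is_matching_subset_edges[OF N] by (rule finite_subset) simp
    have N2: "is_matching (set es) (N - N1)"
      using is_matching_subset_edges[OF N] by (intro is_matching_mono[OF N]) (auto simp: N1_def)
    have "\<forall>e\<in>N - N1. \<not> used' ! fst e \<and> \<not> used' ! snd e"
      using "2.prems"(5) unfolding nth N1_def by auto
    with N2 have *: "(\<Sum>e\<in>N - N1. w e) \<le> 2 * (\<Sum>e\<leftarrow>M. w e)"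
      using "2.IH"(2)[OF refl refl _ refl refl, of "N - N1"] False "2.prems"(1,2,3)
      by (simp add: array_get_def array_set_def M_def used'_def)
    have "(\<Sum>e\<in>N1. w e) \<le> 2 * w (u, v)"
      unfolding N1_def
    proof (rule sum_matching_meeting_edge[OF N fin])
      show "0 \<le> w (u, v)" using "2.prems"(3) by simp
      show "w e \<le> w (u, v)" if "e \<in> N" for e
        using that is_matching_subset_edges[OF N] "2.prems"(2) by auto
    qed
    moreover have "(\<Sum>e\<in>N. w e) = (\<Sum>e\<in>N - N1. w e) + (\<Sum>e\<in>N1. w e)"
      by (rule sum.subset_diff) (use fin in \<open>auto simp: N1_def\<close>)
    ultimately show ?thesis
      unfolding eq using * by simp
  qed
qed

lemma val_greedy_matching:
  "val (greedy_matching n es w) = val (greedy_scan (val (msort_tm w es)) (replicate n False))"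
  by (simp add: greedy_matching_def array_new_def)

lemma distinct_greedy_matching: "distinct es \<Longrightarrow> distinct (val (greedy_matching n es w))"
  by (simp add: val_greedy_matching distinct_greedy_scan)

lemma length_greedy_matching: "length (val (greedy_matching n es w)) \<le> length es"
  using length_greedy_scan[of "val (msort_tm w es)"] by (simp add: val_greedy_matching)

lemma greedy_matching_matching:
  assumes "\<forall>e\<in>set es. fst e < n \<and> snd e < n"
  shows "is_matching (set es) (set (val (greedy_matching n es w)))"
  using greedy_scan_matching[of "val (msort_tm w es)" "replicate n False"] assms
  by (simp add: val_greedy_matching)

lemma greedy_matching_half:
  assumes "\<forall>e\<in>set es. fst e < n \<and> snd e < n" and "distinct es" and "\<forall>e\<in>set es. w e \<ge> 0"
    and "is_matching (set es) N"
  shows "(\<Sum>e\<in>N. w e) \<le> 2 * (\<Sum>e\<in>set (val (greedy_matching n es w)). w e)"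
proof -
  have "\<forall>e\<in>N. \<not> replicate n False ! fst e \<and> \<not> replicate n False ! snd e"
    using assms(1) is_matching_subset_edges[OF assms(4)] by (metis nth_replicate subsetD)
  then have "(\<Sum>e\<in>N. w e) \<le> 2 * (\<Sum>e\<leftarrow>val (greedy_matching n es w). w e)"
    unfolding val_greedy_matching
    by (intro greedy_scan_half sorted_msort_tm) (use assms in auto)
  then show ?thesis
    by (simp add: sum_list_distinct_conv_sum_set distinct_greedy_matching assms(2))
qed

lemma time_greedy_matching:
  assumes "length es \<le> 2 ^ k"
  shows "time (greedy_matching n es w) \<le> 7 * length es * (k + 1) + 5 * length es + n + 6"
  using time_msort_tm[OF assms, of w] time_greedy_scan[of "val (msort_tm w es)" "replicate n False"]
  by (simp add: greedy_matching_def array_new_def)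

section \<open>Binary search\<close>

lemma val_prefix_matching [simp]:
  "val (prefix_matching match n es r i) = val (match n (take i es) r)"
  by (simp add: prefix_matching_def)

lemma binary_search_correct:
  fixes match :: match_alg and n :: nat and es :: "edge list" and r \<sigma> :: "edge \<Rightarrow> real"
    and B :: real and lo hi :: nat
  defines "s \<equiv> \<lambda>i. \<Sum>e\<leftarrow>val (match n (take i es) r). \<sigma> e"
  assumes "lo < hi" "s lo \<le> B" "B < s hi"
  defines "l \<equiv> val (binary_search match n es r \<sigma> B lo hi)"
  shows "l < hi \<and> s l \<le> B \<and> B < s (l + 1)"
  using assms(2-4) unfolding l_def
proof (induction "hi - lo" arbitrary: lo hi rule: less_induct)
  case less
  show ?case
  proof (cases "hi \<le> lo + 1")
    case True
    with less.prems have "hi = lo + 1" by simp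
    with less.prems show ?thesis by (subst (1 2 3) binary_search.simps) simp
  next
    case False
    define mid where "mid = (lo + hi) div 2"
    have mid: "lo < mid" "mid < hi" using False by (auto simp: mid_def)
    show ?thesis
    proof (cases "s mid \<le> B")
      case True
      have "val (binary_search match n es r \<sigma> B lo hi) = val (binary_search match n es r \<sigma> B mid hi)"
        using False True
        by (subst binary_search.simps) (simp add: Let_def mid_def s_def)
      then show ?thesis
        using less.hyps[of hi mid] True mid less.prems by simp
    next
      case over: False
      have "val (binary_search match n es r \<sigma> B lo hi) = val (binary_search match n es r \<sigma> B lo mid)"
        using False over
        by (subst binary_search.simps) (simp add: Let_def mid_def s_def)
      then show ?thesis
        using less.hyps[of mid lo] over mid less.prems by (simp add: diff_less_mono)
    qed
  qed
qed

lemma time_binary_search: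
  assumes "\<And>i. time (prefix_matching match n es r i) + length (val (match n (take i es) r)) \<le> T"
    and "hi - lo \<le> 2 ^ k"
  shows "time (binary_search match n es r \<sigma> B lo hi) \<le> k * (T + 2) + 1"
  using assms(2)
proof (induction k arbitrary: lo hi)
  case 0
  then show ?case by (subst binary_search.simps) simp
next
  case (Suc k)
  show ?case
  proof (cases "hi \<le> lo + 1")
    case True
    then show ?thesis by (subst binary_search.simps) simp
  next
    case False
    define mid where "mid = (lo + hi) div 2"
    have "time (binary_search match n es r \<sigma> B mid hi) \<le> k * (T + 2) + 1"
      "time (binary_search match n es r \<sigma> B lo mid) \<le> k * (T + 2) + 1"
      using Suc.prems by (intro Suc.IH; simp add: mid_def)+
    then show ?thesis
      using False assms(1)[of mid]
      by (subst binary_search.simps) (simp add: Let_def mid_def[symmetric])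
  qed
qed

section \<open>The approximation guarantee\<close>

text \<open>Sorting by ratio, cross-multiplied so that zero denominators need no exception.\<close>

lemma ereal_ratio_le_imp:
  assumes "ereal a / ereal s \<le> ereal b / ereal t" "a > 0" "b > 0" "s \<ge> 0" "t \<ge> 0"
  shows "a * t \<le> b * s"
proof (cases "t = 0")
  case True
  then show ?thesis using assms by simp
next
  case False
  then have "s \<noteq> 0"
    using assms by (auto simp: divide_ereal_def)
  then show ?thesis
    using assms False by (simp add: field_simps)
qed

lemma br_matching_greedy_approx:
  fixes r \<sigma> :: "edge \<Rightarrow> real"
  assumes "distinct E" and nodes: "\<forall>e\<in>set E. fst e < n \<and> snd e < n"
    and "\<forall>e\<in>set E. \<sigma> e \<ge> 0" and "B \<ge> 0"
  defines "M \<equiv> set (val (br_matching greedy_matching n E r \<sigma> B))"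
  shows "is_matching (set E) M" and "(\<Sum>e\<in>M. \<sigma> e) \<le> B"
    and "\<And>N. is_matching (set E) N \<Longrightarrow> (\<Sum>e\<in>N. \<sigma> e) \<le> B \<Longrightarrow> (\<Sum>e\<in>N. r e) \<le> 5 * (\<Sum>e\<in>M. r e)"
proof -
  define key where "key = (\<lambda>e. ereal (r e) / ereal (\<sigma> e))"
  define F where "F = filter (\<lambda>e. \<not> (r e \<le> 0 \<or> \<sigma> e > B)) E"
  define es where "es = val (msort_tm key F)"
  define m where "m = length es"
  define MM where "MM = (\<lambda>i. val (greedy_matching n (take i es) r))"
  define l where "l = val (binary_search greedy_matching n es r \<sigma> B 0 m)"
  have MM: "val (greedy_matching n (take i es) r) = MM i" for i
    by (simp add: MM_def)
  have M_eq: "M = (if (\<Sum>e\<leftarrow>MM m. \<sigma> e) \<le> B then set (MM m)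
      else if r (es ! l) \<le> (\<Sum>e\<leftarrow>MM l. r e) then set (MM l) else {es ! l})"
    unfolding M_def br_matching_def val_simps val_filter_tm key_def[symmetric] F_def[symmetric]
      es_def[symmetric] val_length_tm m_def[symmetric] val_prefix_matching MM val_sum_tm
    by (simp add: l_def MM)
  have set_es: "set es = {e \<in> set E. r e > 0 \<and> \<sigma> e \<le> B}"
    by (auto simp: es_def F_def)
  have dist: "distinct es" using assms(1) by (simp add: es_def F_def)
  have sorted: "sorted_wrt (\<lambda>x y. key x \<ge> key y) es"
    unfolding es_def by (rule sorted_msort_tm)
  have nodes': "\<forall>e\<in>set (take i es). fst e < n \<and> snd e < n" for i
    using nodes set_take_subset[of i es] set_es by blast
  have pos: "\<And>e. e \<in> set es \<Longrightarrow> r e > 0" and \<sigma>0: "\<And>e. e \<in> set es \<Longrightarrow> \<sigma> e \<ge> 0"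
    using assms(3) set_es by auto
  have MM_dist: "distinct (MM i)" for i
    unfolding MM_def using dist by (intro distinct_greedy_matching) simp
  have sum_MM: "(\<Sum>e\<leftarrow>MM i. f e) = (\<Sum>e\<in>set (MM i). f e)" for f :: "edge \<Rightarrow> real" and i
    using MM_dist by (rule sum_list_distinct_conv_sum_set)
  have MM_matching: "is_matching (set (take i es)) (set (MM i))" for i
    unfolding MM_def by (rule greedy_matching_matching[OF nodes'])
  have MM_matching': "is_matching (set E) (set (MM i))" for i
    using is_matching_subset_edges[OF MM_matching[of i]] set_take_subset[of i es] set_es
    by (intro is_matching_mono[OF MM_matching[of i]]) auto
  have half: "(\<Sum>e\<in>N. r e) \<le> 2 * (\<Sum>e\<in>set (MM i). r e)" if "is_matching (set (take i es)) N" for i N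
    unfolding MM_def
  proof (rule greedy_matching_half[OF nodes' _ _ that])
    show "distinct (take i es)" using dist by simp
    show "\<forall>e\<in>set (take i es). r e \<ge> 0"
      using pos set_take_subset[of i es] by (auto simp: less_imp_le subset_iff)
  qed
  have useful: "is_matching (set es) {e \<in> N. r e > 0} \<and>
      (\<Sum>e | e \<in> N \<and> r e > 0. \<sigma> e) \<le> B \<and> (\<Sum>e\<in>N. r e) \<le> (\<Sum>e | e \<in> N \<and> r e > 0. r e)"
    if N: "is_matching (set E) N" and risk: "(\<Sum>e\<in>N. \<sigma> e) \<le> B" for N
  proof -
    have NE: "N \<subseteq> set E" using N by (rule is_matching_subset_edges)
    then have fin: "finite N" by (rule finite_subset) simp
    have "\<sigma> e \<le> B" if "e \<in> N" for e
      using member_le_sum[of e N \<sigma>] that NE assms(3) fin risk by (force simp: subset_iff)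
    then have "is_matching (set es) {e \<in> N. r e > 0}"
      using NE set_es by (intro is_matching_mono[OF N]) auto
    moreover have "(\<Sum>e | e \<in> N \<and> r e > 0. \<sigma> e) \<le> (\<Sum>e\<in>N. \<sigma> e)"
      using fin NE assms(3) by (intro sum_mono2) auto
    moreover have "(\<Sum>e\<in>N. r e) = (\<Sum>e\<in>{e\<in>N. \<not> r e > 0}. r e) + (\<Sum>e | e \<in> N \<and> r e > 0. r e)"
      using fin by (subst sum.union_disjoint[symmetric]) (auto intro: sum.cong)
    moreover have "(\<Sum>e\<in>{e\<in>N. \<not> r e > 0}. r e) \<le> 0"
      by (rule sum_nonpos) auto
    ultimately show ?thesis using risk by linarith
  qed
  have main: "is_matching (set E) M \<and> (\<Sum>e\<in>M. \<sigma> e) \<le> B \<and> (\<forall>N. is_matching (set E) N \<longrightarrow>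
      (\<Sum>e\<in>N. \<sigma> e) \<le> B \<longrightarrow> (\<Sum>e\<in>N. r e) \<le> 5 * (\<Sum>e\<in>M. r e))"
  proof (cases "(\<Sum>e\<in>set (MM m). \<sigma> e) \<le> B")
    case True
    then have M: "M = set (MM m)"
      by (simp add: M_eq sum_MM)
    have "0 \<le> (\<Sum>e\<in>M. r e)"
      using is_matching_subset_edges[OF MM_matching[of m]] pos unfolding M m_def
      by (intro sum_nonneg) (auto simp: less_imp_le subset_iff)
    moreover have "(\<Sum>e\<in>N. r e) \<le> 2 * (\<Sum>e\<in>M. r e)"
      if "is_matching (set E) N" "(\<Sum>e\<in>N. \<sigma> e) \<le> B" for N
      using useful[OF that] half[of m "{e \<in> N. r e > 0}"] by (simp add: m_def M)
    ultimately have "(\<Sum>e\<in>N. r e) \<le> 5 * (\<Sum>e\<in>M. r e)"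
      if "is_matching (set E) N" "(\<Sum>e\<in>N. \<sigma> e) \<le> B" for N
      using that by (smt (verit))
    then show ?thesis
      using True MM_matching' unfolding M by blast
  next
    case False
    define e where "e = es ! l"
    have "MM 0 = []"
      using length_greedy_matching[of n "[]" r] by (simp add: MM_def)
    then have MM0: "(\<Sum>e\<leftarrow>MM 0. \<sigma> e) \<le> B" using assms(4) by simp
    have over: "B < (\<Sum>e\<leftarrow>MM m. \<sigma> e)" using False by (simp add: sum_MM)
    have "m \<noteq> 0" using MM0 over by (cases "m = 0") auto
    then have "l < m \<and> (\<Sum>e\<leftarrow>MM l. \<sigma> e) \<le> B \<and> B < (\<Sum>e\<leftarrow>MM (l + 1). \<sigma> e)"
      using binary_search_correct[where match = greedy_matching and lo = 0 and hi = m and n = n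
          and es = es and r = r and \<sigma> = \<sigma> and B = B] MM0 over
      unfolding MM_def l_def by simp
    then have l: "l < m" and lo: "(\<Sum>e\<in>set (MM l). \<sigma> e) \<le> B"
      and hi: "B < (\<Sum>e\<in>set (MM (l + 1)). \<sigma> e)"
      by (auto simp: sum_MM)
    have M: "M = (if (\<Sum>e\<in>set (MM l). r e) \<ge> r e then set (MM l) else {e})"
      using False by (simp add: M_eq sum_MM e_def)
    have e_in: "e \<in> set es" using l by (simp add: e_def m_def)
    have take_Suc: "take (l + 1) es = take l es @ [e]"
      using l by (simp add: e_def m_def take_Suc_conv_app_nth)
    have key_before: "key e \<le> key x" if "x \<in> set (take (l + 1) es)" for x
      using that sorted l unfolding sorted_wrt_iff_nth_less e_def m_def
      by (auto simp: in_set_conv_nth less_Suc_eq)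
    have key_after: "key x \<le> key e" if x: "x \<in> set es" "x \<notin> set (take l es)" for x
    proof -
      obtain j where j: "j < length es" "x = es ! j"
        using x(1) by (auto simp: in_set_conv_nth)
      with x(2) have "l \<le> j"
        by (metis in_set_conv_nth length_take linorder_not_less min_less_iff_conj nth_take)
      then show ?thesis
        using sorted j unfolding sorted_wrt_iff_nth_less e_def by (cases "l = j") auto
    qed
    have MM_Suc_es: "set (MM (l + 1)) \<subseteq> set es"
      using is_matching_subset_edges[OF MM_matching[of "l + 1"]] set_take_subset[of "l + 1" es] by blast
    have before: "r e * \<sigma> x \<le> r x * \<sigma> e" if "x \<in> set (MM (l + 1))" for x
    proof (rule ereal_ratio_le_imp)
      show "ereal (r e) / ereal (\<sigma> e) \<le> ereal (r x) / ereal (\<sigma> x)"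
        using key_before that is_matching_subset_edges[OF MM_matching[of "l + 1"]]
        unfolding key_def by blast
    qed (use that MM_Suc_es e_in in \<open>blast intro: pos \<sigma>0\<close>)+
    have before_sum: "r e * (\<Sum>x\<in>set (MM (l + 1)). \<sigma> x) \<le> (\<Sum>x\<in>set (MM (l + 1)). r x) * \<sigma> e"
      unfolding sum_distrib_left sum_distrib_right by (rule sum_mono) (rule before)
    have re: "r e > 0" using e_in pos by blast
    have "r e * (\<Sum>x\<in>set (MM (l + 1)). \<sigma> x) > 0"
      using hi assms(4) re by simp
    then have \<sigma>e: "\<sigma> e > 0"
      using before_sum \<sigma>0[OF e_in] by (cases "\<sigma> e = 0") auto
    have Suc_le: "(\<Sum>x\<in>set (MM (l + 1)). r x) \<le> 2 * (\<Sum>x\<in>set (MM l). r x) + r e"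
    proof -
      have "is_matching (set (take l es)) (set (MM (l + 1)) - {e})"
        using is_matching_subset_edges[OF MM_matching[of "l + 1"]] take_Suc
        by (intro is_matching_mono[OF MM_matching[of "l + 1"]]) auto
      then have "(\<Sum>x\<in>set (MM (l + 1)) - {e}. r x) \<le> 2 * (\<Sum>x\<in>set (MM l). r x)"
        by (rule half)
      moreover have "(\<Sum>x\<in>set (MM (l + 1)). r x) \<le> (\<Sum>x\<in>set (MM (l + 1)) - {e}. r x) + r e"
        using re by (simp add: sum_diff1)
      ultimately show ?thesis by linarith
    qed
    have four: "(\<Sum>x\<in>N. r x) \<le> 4 * (\<Sum>x\<in>set (MM l). r x) + r e"
      if "is_matching (set E) N" "(\<Sum>x\<in>N. \<sigma> x) \<le> B" for N
    proof -
      define O' where "O' = {x \<in> N. r x > 0}"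
      define O1 where "O1 = O' \<inter> set (take l es)"
      define O2 where "O2 = O' - set (take l es)"
      have O': "is_matching (set es) O'" "(\<Sum>x\<in>O'. \<sigma> x) \<le> B" "(\<Sum>x\<in>N. r x) \<le> (\<Sum>x\<in>O'. r x)"
        using useful[OF that] by (simp_all add: O'_def)
      have O'_es: "O' \<subseteq> set es" using O'(1) by (rule is_matching_subset_edges)
      then have fin: "finite O'" by (rule finite_subset) simp
      have "is_matching (set (take l es)) O1"
        by (rule is_matching_mono[OF O'(1)]) (auto simp: O1_def)
      then have O1: "(\<Sum>x\<in>O1. r x) \<le> 2 * (\<Sum>x\<in>set (MM l). r x)"
        by (rule half)
      have after: "r x * \<sigma> e \<le> r e * \<sigma> x" if "x \<in> O2" for x
      proof (rule ereal_ratio_le_imp)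
        show "ereal (r x) / ereal (\<sigma> x) \<le> ereal (r e) / ereal (\<sigma> e)"
          using key_after[of x] that O'_es unfolding key_def O2_def by blast
      qed (use that O'_es e_in in \<open>unfold O2_def, blast intro: pos \<sigma>0\<close>)+
      have "(\<Sum>x\<in>O2. r x) * \<sigma> e \<le> r e * (\<Sum>x\<in>O2. \<sigma> x)"
        unfolding sum_distrib_left sum_distrib_right by (rule sum_mono) (rule after)
      also have "(\<Sum>x\<in>O2. \<sigma> x) \<le> (\<Sum>x\<in>O'. \<sigma> x)"
        using fin O'_es \<sigma>0 by (intro sum_mono2) (auto simp: O2_def)
      also have "(\<Sum>x\<in>O'. \<sigma> x) \<le> (\<Sum>x\<in>set (MM (l + 1)). \<sigma> x)"
        using O'(2) hi by linarith
      also note before_sum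
      finally have "(\<Sum>x\<in>O2. r x) \<le> (\<Sum>x\<in>set (MM (l + 1)). r x)"
        using re \<sigma>e by simp
      moreover have "(\<Sum>x\<in>O'. r x) = (\<Sum>x\<in>O1. r x) + (\<Sum>x\<in>O2. r x)"
        unfolding O1_def O2_def using fin by (rule sum.Int_Diff)
      ultimately show ?thesis using O1 O'(3) Suc_le by linarith
    qed
    have single: "is_matching (set E) {e}" "\<sigma> e \<le> B"
      using e_in set_es by (auto simp: is_matching_def)
    show ?thesis
    proof (intro conjI allI impI)
      show "is_matching (set E) M" "(\<Sum>e\<in>M. \<sigma> e) \<le> B"
        using single MM_matching'[of l] lo by (simp_all add: M)
      show "(\<Sum>e\<in>N. r e) \<le> 5 * (\<Sum>e\<in>M. r e)"
        if "is_matching (set E) N" "(\<Sum>e\<in>N. \<sigma> e) \<le> B" for N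
        using four[OF that] by (simp add: M)
    qed
  qed
  from main show "is_matching (set E) M" by (rule conjunct1)
  from main show "(\<Sum>e\<in>M. \<sigma> e) \<le> B" by (elim conjE)
  from main show "(\<Sum>e\<in>N. r e) \<le> 5 * (\<Sum>e\<in>M. r e)"
    if "is_matching (set E) N" "(\<Sum>e\<in>N. \<sigma> e) \<le> B" for N
    using that by (elim conjE allE[of _ N] impE)
qed

lemma std_dev_nonneg: "std_dev G e \<ge> 0"
  by (simp add: std_dev_def)

lemma br_greedy_approximation:
  assumes "uncertain_graph G" "0 \<le> B"
  shows "br_approximation (1/5) G B (set (val (br_greedy G B)))"
proof -
  let ?M = "set (val (br_greedy G B))"
  have G: "distinct (edge_list G)" "\<forall>e\<in>set (edge_list G). fst e < num_nodes G \<and> snd e < num_nodes G"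
    using assms(1) by (auto simp: uncertain_graph_def)
  have "\<forall>e\<in>set (edge_list G). std_dev G e \<ge> 0"
    by (simp add: std_dev_nonneg)
  note approx = br_matching_greedy_approx[OF G this assms(2), where r = "exp_reward G",
      folded br_greedy_def]
  have "finite (br_feasible G B)"
    by (rule finite_subset[of _ "Pow (set (edge_list G))"])
      (auto simp: br_feasible_def is_matching_def)
  moreover have "{} \<in> br_feasible G B"
    using assms(2) by (simp add: br_feasible_def is_matching_def risk_def)
  ultimately have "br_opt G B \<in> reward G ` br_feasible G B"
    unfolding br_opt_def by (intro Max_in) auto
  then have "br_opt G B \<le> 5 * reward G ?M"
    using approx(3) by (auto simp: br_feasible_def risk_def reward_def)
  then show ?thesis
    using approx(1,2) by (simp add: br_approximation_def br_feasible_def risk_def)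
qed

section \<open>The running time\<close>

lemma time_br_matching_greedy:
  assumes "length E \<le> 2 ^ k"
  shows "time (br_matching greedy_matching n E r \<sigma> B)
    \<le> (k + 3) * (7 * length E * (k + 1) + 7 * length E + n + 10) + 5 * length E + 10"
proof -
  define key where "key = (\<lambda>e. ereal (r e) / ereal (\<sigma> e))"
  define F where "F = filter (\<lambda>e. \<not> (r e \<le> 0 \<or> \<sigma> e > B)) E"
  define es where "es = val (msort_tm key F)"
  define m where "m = length es"
  define T where "T = 7 * length E * (k + 1) + 7 * length E + n + 8"
  let ?P = "prefix_matching greedy_matching n es r"
  have F: "length F \<le> length E" unfolding F_def by (rule length_filter_le)
  then have m: "m \<le> length E" by (simp add: m_def es_def)
  have es_k: "length es \<le> 2 ^ k" using m assms by (simp add: m_def)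
  have T: "time (?P i) + length (val (greedy_matching n (take i es) r)) \<le> T" for i
  proof -
    have le: "length (take i es) \<le> length E" using m by (simp add: m_def)
    have "time (greedy_matching n (take i es) r)
        \<le> 7 * length (take i es) * (k + 1) + 5 * length (take i es) + n + 6"
      by (rule time_greedy_matching) (use es_k in simp)
    also have "\<dots> \<le> 7 * length E * (k + 1) + 5 * length E + n + 6"
      using le by (intro add_mono mult_mono) auto
    finally show ?thesis
      using time_take_tm_length[of i es] length_greedy_matching[of n "take i es" r] le m
      by (simp add: prefix_matching_def T_def m_def)
  qed
  have bs: "time (binary_search greedy_matching n es r \<sigma> B 0 m) \<le> k * (T + 2) + 1"
    by (rule time_binary_search[OF T]) (use es_k in \<open>simp add: m_def\<close>)
  have sort: "time (msort_tm key F) \<le> T"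
  proof -
    have "7 * length F * (k + 1) \<le> 7 * length E * (k + 1)"
      using F by (intro mult_mono) auto
    then have "7 * length F * (k + 1) + 3 \<le> T"
      unfolding T_def by linarith
    then show ?thesis
      using time_msort_tm[of F k key] F assms by simp
  qed
  have "time (br_matching greedy_matching n E r \<sigma> B)
    \<le> 1 + (length E + 1) + T + (m + 1) + (T + 1) + (k * (T + 2) + 1) + (T + 1) + (m + 1)"
    using sort bs T[of m] T[of "val (binary_search greedy_matching n es r \<sigma> B 0 m)"]
      time_nth_tm[of es "val (binary_search greedy_matching n es r \<sigma> B 0 m)"]
    unfolding br_matching_def val_simps time_simps val_filter_tm key_def[symmetric]
      F_def[symmetric] es_def[symmetric] val_length_tm m_def[symmetric]
    by (simp add: m_def[symmetric])
  also have "\<dots> \<le> (k + 3) * (T + 2) + 5 * length E + 10"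
    using m by (simp add: algebra_simps)
  also have "T + 2 = 7 * length E * (k + 1) + 7 * length E + n + 10"
    by (simp add: T_def)
  finally show ?thesis .
qed

lemma time_br_greedy:
  assumes "uncertain_graph G" "2 \<le> num_edges G"
  shows "real (time (br_greedy G B)) \<le> 1000 * (real (num_edges G) * (log 2 (real (num_edges G)))\<^sup>2
    + real (num_nodes G) * log 2 (real (num_edges G)))"
proof -
  define m n L k where "m = num_edges G" and "n = num_nodes G" and "L = log 2 (real m)"
    and "k = nat \<lceil>L\<rceil>"
  have len: "length (edge_list G) = m"
    using assms(1) by (simp add: m_def num_edges_def uncertain_graph_def distinct_card)
  have m2: "2 \<le> m" using assms(2) by (simp add: m_def)
  then have L1: "1 \<le> L" by (simp add: L_def le_log_iff)
  have k: "real k \<le> 2 * L" "1 \<le> k" "L \<le> real k"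
    using L1 unfolding k_def by linarith+
  have "real m = 2 powr L" using m2 by (simp add: L_def)
  also have "\<dots> \<le> 2 powr real k" using k by simp
  also have "\<dots> = real (2 ^ k)" by (simp add: powr_realpow)
  finally have "m \<le> 2 ^ k" using of_nat_le_iff by blast
  then have "time (br_greedy G B)
      \<le> (k + 3) * (7 * m * (k + 1) + 7 * m + n + 10) + 5 * m + 10"
    using time_br_matching_greedy[of "edge_list G" k] by (simp add: br_greedy_def len n_def)
  also have "\<dots> \<le> (4 * k) * (14 * m * k + 7 * m * k + n + 10 * m * k) + 5 * m * k\<^sup>2 + 10 * m * k\<^sup>2"
  proof -
    have mk: "m \<le> m * k" "1 \<le> m * k" "m \<le> m * k\<^sup>2" "1 \<le> m * k\<^sup>2"
      using k(2) m2 by simp_all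
    have "7 * m * (k + 1) + 7 * m + n + 10 \<le> 14 * m * k + 7 * m * k + n + 10 * m * k"
    proof -
      have "7 * m * (k + 1) = 7 * (m * k) + 7 * m" by (simp add: algebra_simps)
      then show ?thesis using mk(1,2) by (simp only: mult.assoc)
    qed
    then have "(k + 3) * (7 * m * (k + 1) + 7 * m + n + 10)
        \<le> (4 * k) * (14 * m * k + 7 * m * k + n + 10 * m * k)"
      by (intro mult_mono) (use k(2) in auto)
    then show ?thesis by (intro add_mono) (use mk in simp_all)
  qed
  also have "\<dots> = 139 * m * k\<^sup>2 + 4 * n * k"
    by (simp add: algebra_simps power2_eq_square)
  finally have "real (time (br_greedy G B)) \<le> real (139 * m * k\<^sup>2 + 4 * n * k)"
    using of_nat_le_iff by blast
  also have "\<dots> = 139 * real m * (real k)\<^sup>2 + 4 * real n * real k" by simp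
  also have "\<dots> \<le> 139 * real m * (2 * L)\<^sup>2 + 4 * real n * (2 * L)"
    using k by (intro add_mono mult_left_mono power_mono) auto
  also have "\<dots> = 556 * (real m * L\<^sup>2) + 8 * (real n * L)"
    by (simp add: power_mult_distrib)
  also have "\<dots> \<le> 1000 * (real m * L\<^sup>2) + 1000 * (real n * L)"
    using L1 by (intro add_mono mult_right_mono) auto
  finally show ?thesis
    by (simp add: m_def n_def L_def distrib_left)
qed

theorem theorem2:
  shows "(\<forall>G B. uncertain_graph G \<and> 0 \<le> B \<longrightarrow>
            br_approximation (1/5) G B (set (val (br_greedy G B)))) \<and>
         (\<exists>C::real. \<forall>G B. uncertain_graph G \<and> 0 \<le> B \<and> 2 \<le> num_edges G \<longrightarrow>
            real (time (br_greedy G B)) \<le>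
              C * (real (num_edges G) * (log 2 (real (num_edges G)))\<^sup>2
                   + real (num_nodes G) * log 2 (real (num_edges G))))"
  using br_greedy_approximation time_br_greedy by blast

end
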